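(* Let $k,\ell$ be positive integers. For every $i=1,2,\ldots,\min(k,\ell)$ one has $$ q^i \begin{bmatrix} k\\ i\end{bmatrix}_q \begin{bmatrix} \ell\\ i\end{bmatrix}'_{q,k} =\sum_{\substack{\lambda:\ \lambda_1=i,\\ \lambda^{\omega(k)} \subseteq (k^\ell)}} q^{|\lambda|}, $$ where the sum runs over all partitions $\lambda$ whose largest part is $\lambda_1=i$ and whose $k$-conjugate $\lambda^{\omega(k)}$ fits inside the $\ell\times k$ rectangle $(k^\ell)$.
   Context: Notation: $[n]_q=1+q+\cdots+q^{n-1}$, $[n]!_q=[n]_q[n-1]_q\cdots[1]_q$, and $\begin{bmatrix} a\\ b\end{bmatrix}_q=\frac{[a]!_q}{[b]!_q[a-b]!_q}$ is the $q$-binomial coefficient. For $i\ge 1$ define $$\begin{bmatrix} \ell\\ i\end{bmatrix}'_{q,k}:=\sum_{j=0}^{\ell-i} q^{j(k-i+1)}\begin{bmatrix} i+j-1\\ j\end{bmatrix}_q.$$ Partitions are identified with their Ferrers diagrams (English convention); $|\lambda|=\sum_i\lambda_i$, $\lambda^t$ is the conjugate (transpose) partition, and $\lambda\subseteq(k^\ell)$ means $\lambda$ has at most $\ell$ nonzero parts, each at most $k$. A partition is $k$-bounded if $\lambda_1\le k$. The hook length $h(x)$ of a cell $x$ of a diagram is the number of cells weakly to its right in its row plus the number strictly below it in its column. A partition is a $(k+1)$-core if no cell has hook length exactly $k+1$. Let $p$ be the map from $(k+1)$-cores to $k$-bounded partitions which deletes every cell of hook length greater than $k+1$ and left-justifies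 the remaining cells (so row $r$ of $p(c)$ has length equal to the number of cells in row $r$ of $c$ with hook length at most $k$); it is known that $p$ is a bijection. For a $k$-bounded partition $\lambda$, its $k$-conjugate is $\lambda^{\omega(k)}:=p\big((p^{-1}(\lambda))^t\big)$. *)

theory Defs
  imports "HOL-Computational_Algebra.Polynomial"
begin

text \<open>\<open>q\<close> is an indeterminate: every identity is one of integer polynomials in \<open>q\<close>.\<close>

abbreviation qX :: "int poly" where
  "qX \<equiv> [:0, 1:]"

definition qint :: "nat \<Rightarrow> int poly" where
  "qint n = (\<Sum>j<n. qX ^ j)"

definition qfact :: "nat \<Rightarrow> int poly" where
  "qfact n = (\<Prod>m=1..n. qint m)"

text \<open>Meaningful for \<open>b \<le> a\<close>; the division is then exact, see \<open>qbinom_exact\<close> below.\<close>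

definition qbinom :: "nat \<Rightarrow> nat \<Rightarrow> int poly" where
  "qbinom a b = qfact a div (qfact b * qfact (a - b))"

text \<open>The primed coefficient \<open>[\<ell>, i]'\<close> with parameters \<open>q, k\<close>, for \<open>1 \<le> i \<le> k + 1\<close>. The
  condition \<open>i + j \<le> l\<close> renders the summation range \<open>0 \<le> j \<le> l - i\<close> without truncated
  subtraction.\<close>

definition qbinom_prime :: "nat \<Rightarrow> nat \<Rightarrow> nat \<Rightarrow> int poly" where
  "qbinom_prime k l i = (\<Sum>j | i + j \<le> l. qX ^ (j * (k + 1 - i)) * qbinom (i + j - 1) j)"

lemma qint_add: "qint (m + n) = qint m + qX ^ m * qint n"
proof (induction n)
  case 0
  then show ?case by (simp add: qint_def)
next
  case (Suc n)
  then show ?case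
    by (simp only: qint_def add_Suc_right sum.lessThan_Suc) (simp only: power_add algebra_simps)
qed

lemma qfact_Suc: "qfact (Suc n) = qfact n * qint (Suc n)"
  by (simp add: qfact_def)

lemma qfact_mult_dvd: "qfact m * qfact n dvd qfact (m + n)"
proof (induction "m + n" arbitrary: m n)
  case 0
  then show ?case by (simp add: qfact_def)
next
  case (Suc s)
  show ?case
  proof (cases "m = 0 \<or> n = 0")
    case True
    then show ?thesis by (auto simp: qfact_def)
  next
    case False
    then obtain a b where ab: "m = Suc a" "n = Suc b"
      by (metis not0_implies_Suc)
    have s: "s = a + Suc b" "s = Suc a + b"
      using Suc.hyps(2) ab by auto
    obtain g where g: "qfact s = qfact a * qfact (Suc b) * g"
      using Suc.hyps(1)[OF s(1)] s(1) by (auto elim: dvdE)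
    obtain h where h: "qfact s = qfact (Suc a) * qfact b * h"
      using Suc.hyps(1)[OF s(2)] s(2) by (auto elim: dvdE)
    have "qfact (m + n) = qfact s * qint (Suc a + Suc b)"
      using Suc.hyps(2) ab by (metis qfact_Suc)
    also have "\<dots> = qfact s * qint (Suc a) + qX ^ Suc a * (qfact s * qint (Suc b))"
      by (simp only: qint_add algebra_simps)
    also have "qfact s * qint (Suc a) = qfact m * qfact n * g"
      by (simp only: g ab qfact_Suc[of a] mult_ac)
    also have "qfact s * qint (Suc b) = qfact m * qfact n * h"
      by (simp only: h ab qfact_Suc[of b] mult_ac)
    finally have "qfact (m + n) = qfact m * qfact n * (g + qX ^ Suc a * h)"
      by (simp only: algebra_simps)
    then show ?thesis by (rule dvdI)
  qed
qed

lemma qbinom_exact: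
  assumes "b \<le> a"
  shows "qbinom a b * (qfact b * qfact (a - b)) = qfact a"
  using qfact_mult_dvd[of b "a - b"] assms by (simp add: qbinom_def)

text \<open>A partition is the sequence of its parts, indexed from 0 and padded with zeros: the part
  \<open>\<mu>\<^sub>1\<close> is \<open>\<mu> 0\<close>. Cells are pairs (row, column), both counted from 0.\<close>

definition is_partition :: "(nat \<Rightarrow> nat) \<Rightarrow> bool" where
  "is_partition \<mu> \<longleftrightarrow> antimono \<mu> \<and> finite {r. \<mu> r \<noteq> 0}"

definition psize :: "(nat \<Rightarrow> nat) \<Rightarrow> nat" where
  "psize \<mu> = (\<Sum>r | \<mu> r \<noteq> 0. \<mu> r)"

definition cells :: "(nat \<Rightarrow> nat) \<Rightarrow> (nat \<times> nat) set" where
  "cells \<mu> = {(r, c). c < \<mu> r}"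

definition conjugate :: "(nat \<Rightarrow> nat) \<Rightarrow> nat \<Rightarrow> nat" where
  "conjugate \<mu> c = card {r. (r, c) \<in> cells \<mu>}"

definition rectangle :: "nat \<Rightarrow> nat \<Rightarrow> nat \<Rightarrow> nat" where
  "rectangle k l r = (if r < l then k else 0)"

definition hook_length :: "(nat \<Rightarrow> nat) \<Rightarrow> nat \<times> nat \<Rightarrow> nat" where
  "hook_length \<mu> = (\<lambda>(r, c). card {c'. c \<le> c' \<and> (r, c') \<in> cells \<mu>}
                           + card {r'. r < r' \<and> (r', c) \<in> cells \<mu>})"

definition cores :: "nat \<Rightarrow> (nat \<Rightarrow> nat) set" where
  "cores n = {\<mu>. is_partition \<mu> \<and> (\<forall>x \<in> cells \<mu>. hook_length \<mu> x \<noteq> n)}"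

text \<open>The map \<open>p\<close> from \<open>(k+1)\<close>-cores to \<open>k\<close>-bounded partitions. It deletes the cells of hook
  length greater than \<open>k + 1\<close>; as a \<open>(k+1)\<close>-core has none of hook length \<open>k + 1\<close>, those of hook
  length at most \<open>k\<close> remain. As \<open>p\<close> is a bijection, \<open>inv_into\<close> below gives the unique preimage
  of a \<open>k\<close>-bounded partition.\<close>

definition core_to_bounded :: "nat \<Rightarrow> (nat \<Rightarrow> nat) \<Rightarrow> nat \<Rightarrow> nat" where
  "core_to_bounded k \<kappa> r = card {c. (r, c) \<in> cells \<kappa> \<and> hook_length \<kappa> (r, c) \<le> k}"

definition k_conjugate :: "nat \<Rightarrow> (nat \<Rightarrow> nat) \<Rightarrow> nat \<Rightarrow> nat" where
  "k_conjugate k \<mu> =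
     core_to_bounded k (conjugate (inv_into (cores (k + 1)) (core_to_bounded k) \<mu>))"

end

theory Submission
  imports Defs
begin

text \<open>If \<open>\<kappa>\<close> is the \<open>(k + 1)\<close>-core of a \<open>k\<close>-bounded partition \<open>\<mu>\<close>, then, with rows counted from 0,
  \<open>\<kappa> r = \<mu> r + \<kappa> (r + k + 1 - \<mu> r)\<close>: the cells of row \<open>r\<close> with large hooks are those in a column
  that reaches row \<open>r + k + 1 - \<mu> r\<close>. The \<open>k\<close>-conjugate has as many rows as \<open>\<kappa>\<close> has columns, so it
  fits in the rectangle iff \<open>\<kappa> 0 \<le> l\<close>.

  Let \<open>F\<^sub>i(n)\<close> enumerate by size the partitions with \<open>\<mu> 0 = i\<close> and \<open>\<kappa> 0 = n\<close>. Since
  \<open>\<kappa> 0 = i + \<kappa> (k + 1 - i)\<close>, cutting \<open>\<mu>\<close> at row \<open>k + 1 - i\<close> gives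
  \<open>F\<^sub>i(i + j) = q^i \<Sum>\<^sub>s q^(s (k - i)) [k - s, i - s] F\<^sub>s(j)\<close>, and the \<open>q\<close>-Vandermonde identity shows by
  induction that \<open>F\<^sub>i(i + j) = q^i [k, i] q^(j (k + 1 - i)) [i + j - 1, j]\<close>.\<close>

section \<open>Hook lengths and conjugation\<close>

text \<open>Each column of a partition is an initial segment of the rows, so its cardinality is the
  first row that it misses. Later comparisons of columns with rows pass through this
  equivalence.\<close>

lemma less_conjugate_iff:
  assumes "is_partition \<mu>"
  shows "r < conjugate \<mu> c \<longleftrightarrow> c < \<mu> r"
proof -
  define n where "n = (LEAST n. \<mu> n \<le> c)"
  have "finite {r. \<mu> r \<noteq> 0}" and anti: "antimono \<mu>"
    using assms by (auto simp: is_partition_def)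
  then obtain m where "\<mu> m = 0"
    by (metis (mono_tags, lifting) ex_new_if_finite infinite_UNIV_nat mem_Collect_eq)
  then have n: "\<mu> n \<le> c"
    unfolding n_def by (metis LeastI zero_le)
  have "{r. c < \<mu> r} = {..<n}"
  proof (intro set_eqI iffI)
    fix r assume "r \<in> {r. c < \<mu> r}"
    then show "r \<in> {..<n}"
      using n antimonoD[OF anti, of n r] by (cases "r < n") auto
  next
    fix r assume "r \<in> {..<n}"
    then show "r \<in> {r. c < \<mu> r}"
      using not_less_Least[of r "\<lambda>n. \<mu> n \<le> c"] by (auto simp: n_def)
  qed
  then show ?thesis
    by (simp add: conjugate_def cells_def) (metis lessThan_iff mem_Collect_eq)
qed

lemma hook_length_eq:
  assumes "is_partition \<mu>"
  shows "hook_length \<mu> (r, c) = (\<mu> r - c) + (conjugate \<mu> c - Suc r)"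
proof -
  have "{c'. c \<le> c' \<and> (r, c') \<in> cells \<mu>} = {c..<\<mu> r}"
    by (auto simp: cells_def)
  moreover have "{r'. r < r' \<and> (r', c) \<in> cells \<mu>} = {Suc r..<conjugate \<mu> c}"
    using less_conjugate_iff[OF assms] by (auto simp: cells_def)
  ultimately show ?thesis
    by (simp add: hook_length_def)
qed

lemma is_partition_conjugate:
  assumes "is_partition \<mu>"
  shows "is_partition (conjugate \<mu>)"
  unfolding is_partition_def
proof
  show "antimono (conjugate \<mu>)"
  proof (rule antimonoI)
    fix c d :: nat assume "c \<le> d"
    show "conjugate \<mu> d \<le> conjugate \<mu> c"
    proof (rule ccontr)
      assume "\<not> ?thesis"
      then show False
        using less_conjugate_iff[OF assms, of "conjugate \<mu> c" d]
          less_conjugate_iff[OF assms, of "conjugate \<mu> c" c] \<open>c \<le> d\<close> by auto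
    qed
  qed
  have "{c. conjugate \<mu> c \<noteq> 0} \<subseteq> {..<\<mu> 0}"
    using less_conjugate_iff[OF assms, of 0] by auto
  then show "finite {c. conjugate \<mu> c \<noteq> 0}"
    using finite_subset by blast
qed

lemma conjugate_conjugate:
  assumes "is_partition \<mu>"
  shows "conjugate (conjugate \<mu>) = \<mu>"
proof
  fix r
  have "c < conjugate (conjugate \<mu>) r \<longleftrightarrow> c < \<mu> r" for c
    using assms by (simp add: less_conjugate_iff is_partition_conjugate)
  then show "conjugate (conjugate \<mu>) r = \<mu> r"
    by (metis linorder_neqE_nat nat_less_le)
qed

text \<open>Transposition exchanges arm and leg of a cell, so hook lengths are preserved.\<close>

lemma conjugate_in_cores:
  assumes "\<kappa> \<in> cores n"
  shows "conjugate \<kappa> \<in> cores n"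
proof -
  have part: "is_partition \<kappa>"
    using assms by (simp add: cores_def)
  have "hook_length (conjugate \<kappa>) (c, r) \<noteq> n" if "r < conjugate \<kappa> c" for r c
  proof -
    have rc: "c < \<kappa> r"
      using that less_conjugate_iff[OF part] by simp
    then have "hook_length \<kappa> (r, c) \<noteq> n"
      using assms by (auto simp: cores_def cells_def)
    then show ?thesis
      using that rc part
      by (simp add: hook_length_eq is_partition_conjugate conjugate_conjugate)
  qed
  then show ?thesis
    using part by (auto simp: cores_def cells_def is_partition_conjugate)
qed

section \<open>The row recurrence for cores\<close>

text \<open>\<open>case_nat a \<kappa>\<close> places a row of length \<open>a\<close> on top of
  \<open>\<kappa>\<close>; this decomposition drives the row-by-row inductions.\<close>

lemma case_nat_head_tail: "case_nat (\<mu> 0) (\<lambda>r. \<mu> (Suc r)) = \<mu>"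
  by (rule ext) (simp split: nat.split)

lemma case_nat_support:
  "{r. case_nat i \<mu> r \<noteq> 0} \<subseteq> insert 0 (Suc ` {r. \<mu> r \<noteq> 0})" for \<mu> :: "nat \<Rightarrow> nat"
proof
  fix r assume "r \<in> {r. case_nat i \<mu> r \<noteq> 0}"
  then show "r \<in> insert 0 (Suc ` {r. \<mu> r \<noteq> 0})"
    by (cases r) auto
qed

lemma is_partition_case_nat:
  "is_partition (case_nat i \<mu>) \<longleftrightarrow> \<mu> 0 \<le> i \<and> is_partition \<mu>"
proof -
  have "antimono (case_nat i \<mu>) \<longleftrightarrow> \<mu> 0 \<le> i \<and> antimono \<mu>"
    unfolding antimono_iff_le_Suc
    by (metis (no_types, lifting) nat.exhaust old.nat.simps(4) old.nat.simps(5))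
  moreover have "finite {r. case_nat i \<mu> r \<noteq> 0} \<longleftrightarrow> finite {r. \<mu> r \<noteq> 0}"
  proof -
    have "Suc ` {r. \<mu> r \<noteq> 0} \<subseteq> {r. case_nat i \<mu> r \<noteq> 0}"
      by auto
    then show ?thesis
      by (metis case_nat_support finite.insertI finite_imageD finite_imageI finite_subset inj_Suc)
  qed
  ultimately show ?thesis
    by (auto simp: is_partition_def)
qed

lemma psize_case_nat:
  assumes "is_partition \<mu>"
  shows "psize (case_nat i \<mu>) = i + psize \<mu>"
proof -
  have fin: "finite {r. \<mu> r \<noteq> 0}"
    using assms by (simp add: is_partition_def)
  have "psize (case_nat i \<mu>) = (\<Sum>r \<in> insert 0 (Suc ` {r. \<mu> r \<noteq> 0}). case_nat i \<mu> r)"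
    unfolding psize_def
    by (rule sum.mono_neutral_left[OF _ case_nat_support]) (use fin in auto)
  also have "\<dots> = i + psize \<mu>"
    using fin by (simp add: psize_def sum.reindex)
  finally show ?thesis .
qed

text \<open>Hooks extend only to the right and downwards, so a row added on top leaves them
  unchanged.\<close>

lemma hook_length_case_nat_Suc:
  "hook_length (case_nat a \<kappa>) (Suc r, c) = hook_length \<kappa> (r, c)"
proof -
  have "{r'. Suc r < r' \<and> c < case_nat a \<kappa> r'} = Suc ` {r'. r < r' \<and> c < \<kappa> r'}"
  proof (intro set_eqI iffI)
    fix r' assume "r' \<in> {r'. Suc r < r' \<and> c < case_nat a \<kappa> r'}"
    then show "r' \<in> Suc ` {r'. r < r' \<and> c < \<kappa> r'}"
      by (cases r') auto
  qed auto
  then show ?thesis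
    by (simp add: hook_length_def cells_def card_image)
qed

lemma hook_length_case_nat_0:
  "hook_length (case_nat a \<kappa>) (0, c) = (a - c) + conjugate \<kappa> c"
proof -
  have "{r'. 0 < r' \<and> c < case_nat a \<kappa> r'} = Suc ` {r'. c < \<kappa> r'}"
    by (auto simp: image_iff split: nat.splits) (metis gr0_conv_Suc old.nat.simps(5))
  moreover have "{c'. c \<le> c' \<and> c' < a} = {c..<a}"
    by auto
  ultimately show ?thesis
    by (simp add: hook_length_def cells_def card_image conjugate_def)
qed

lemma case_nat_in_cores_iff:
  "case_nat a \<kappa> \<in> cores n \<longleftrightarrow>
    \<kappa> \<in> cores n \<and> \<kappa> 0 \<le> a \<and> (\<forall>c<a. (a - c) + conjugate \<kappa> c \<noteq> n)"
proof -
  have "(\<forall>x \<in> cells (case_nat a \<kappa>). hook_length (case_nat a \<kappa>) x \<noteq> n) \<longleftrightarrow>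
    (\<forall>x \<in> cells \<kappa>. hook_length \<kappa> x \<noteq> n) \<and> (\<forall>c<a. (a - c) + conjugate \<kappa> c \<noteq> n)"
    (is "?L \<longleftrightarrow> ?R")
  proof
    assume L: ?L
    have "hook_length \<kappa> (r, c) \<noteq> n" if "c < \<kappa> r" for r c
      using bspec[OF L, of "(Suc r, c)"] that by (simp add: cells_def hook_length_case_nat_Suc)
    moreover have "(a - c) + conjugate \<kappa> c \<noteq> n" if "c < a" for c
      using bspec[OF L, of "(0, c)"] that by (simp add: cells_def hook_length_case_nat_0)
    ultimately show ?R
      by (auto simp: cells_def)
  next
    assume R: ?R
    have "hook_length (case_nat a \<kappa>) (r, c) \<noteq> n" if "c < case_nat a \<kappa> r" for r c
      using that R
      by (cases r) (auto simp: cells_def hook_length_case_nat_0 hook_length_case_nat_Suc)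
    then show ?L
      by (auto simp: cells_def)
  qed
  then show ?thesis
    by (auto simp: cores_def is_partition_case_nat)
qed

lemma core_to_bounded_case_nat:
  "core_to_bounded k (case_nat a \<kappa>) =
    case_nat (card {c. c < a \<and> (a - c) + conjugate \<kappa> c \<le> k}) (core_to_bounded k \<kappa>)"
  by (rule ext)
    (auto simp: core_to_bounded_def cells_def hook_length_case_nat_0 hook_length_case_nat_Suc
      split: nat.split)

text \<open>Along the first row hook lengths strictly decrease, so the cells of hook length at most \<open>k\<close>
  are the last \<open>i\<close> ones, and the column just before them has height exceeding \<open>k - i\<close>.\<close>

lemma first_row_of_core:
  assumes part: "is_partition \<kappa>" and "\<kappa> 0 \<le> a"
    and ne: "\<forall>c<a. (a - c) + conjugate \<kappa> c \<noteq> k + 1"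
    and i: "i = card {c. c < a \<and> (a - c) + conjugate \<kappa> c \<le> k}"
  shows "i \<le> k \<and> a = i + \<kappa> (k - i)"
proof -
  \<comment> \<open>The disjunct \<open>a \<le> c\<close> makes \<open>?P a\<close> true, so the
    least column exists, and it is \<open>a\<close> if no cell has a short hook.\<close>
  let ?P = "\<lambda>c. a \<le> c \<or> (a - c) + conjugate \<kappa> c \<le> k"
  define s where "s = (LEAST c. ?P c)"
  have s: "?P s"
    unfolding s_def by (rule LeastI[of ?P a]) simp
  have sa: "s \<le> a"
    unfolding s_def by (rule Least_le) simp
  have anti: "antimono (conjugate \<kappa>)"
    using is_partition_conjugate[OF part] by (simp add: is_partition_def)
  have "{c. c < a \<and> (a - c) + conjugate \<kappa> c \<le> k} = {s..<a}"
  proof (intro set_eqI iffI)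
    fix c assume "c \<in> {c. c < a \<and> (a - c) + conjugate \<kappa> c \<le> k}"
    then show "c \<in> {s..<a}"
      using Least_le[of ?P c] by (auto simp: s_def)
  next
    fix c assume "c \<in> {s..<a}"
    then show "c \<in> {c. c < a \<and> (a - c) + conjugate \<kappa> c \<le> k}"
      using s antimonoD[OF anti, of s c] by auto
  qed
  then have is': "i = a - s"
    using i by simp
  have ik: "i \<le> k"
    using s is' by auto
  have "\<kappa> (k - i) \<le> s"
  proof (cases "s = a")
    case True
    have "antimono \<kappa>"
      using part by (simp add: is_partition_def)
    then show ?thesis
      using True \<open>\<kappa> 0 \<le> a\<close> antimonoD[of \<kappa> 0 "k - i"] by simp
  next
    case False
    then have "conjugate \<kappa> s \<le> k - i"
      using s sa is' by simp
    then show ?thesis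
      using less_conjugate_iff[OF part, of "k - i" s] by simp
  qed
  moreover have "s \<le> \<kappa> (k - i)"
  proof (cases s)
    case (Suc c)
    then have "\<not> ?P c"
      unfolding s_def by (intro not_less_Least) simp
    \<comment> \<open>The core condition enters here: a hook longer than \<open>k\<close> has length
      at least \<open>k + 2\<close>, which makes the next inequality strict.\<close>
    then have "k + 1 < (a - c) + conjugate \<kappa> c"
      using ne by (metis Suc_eq_plus1 not_le not_less_eq linorder_neqE_nat)
    then have "k - i < conjugate \<kappa> c"
      using is' sa ik Suc by linarith
    then show ?thesis
      using less_conjugate_iff[OF part, of "k - i" c] Suc by simp
  qed simp
  ultimately show ?thesis
    using is' sa ik by simp
qed

text \<open>Left of column \<open>\<kappa> (k - i)\<close> the arm (its own cell included) exceeds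
  \<open>i\<close> and the column height exceeds \<open>k - i\<close>; from that column on neither
  happens. So the hook lengths jump over \<open>k + 1\<close>.\<close>

lemma new_first_row_of_core:
  assumes part: "is_partition \<kappa>" and "i \<le> k" and a: "a = i + \<kappa> (k - i)"
  shows "\<forall>c<a. (a - c) + conjugate \<kappa> c \<noteq> k + 1"
    and "card {c. c < a \<and> (a - c) + conjugate \<kappa> c \<le> k} = i"
proof -
  have *: "(if c < \<kappa> (k - i) then k + 1 < (a - c) + conjugate \<kappa> c
    else (a - c) + conjugate \<kappa> c \<le> k)" if "c < a" for c
    using less_conjugate_iff[OF part, of "k - i" c] that \<open>i \<le> k\<close> by (auto simp: a)
  then show "\<forall>c<a. (a - c) + conjugate \<kappa> c \<noteq> k + 1"
    by (metis Suc_eq_plus1 less_irrefl not_less_eq_eq order_refl)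
  have "{c. c < a \<and> (a - c) + conjugate \<kappa> c \<le> k} = {\<kappa> (k - i)..<a}"
  proof (intro set_eqI iffI)
    fix c assume "c \<in> {c. c < a \<and> (a - c) + conjugate \<kappa> c \<le> k}"
    then show "c \<in> {\<kappa> (k - i)..<a}"
      using *[of c] by (auto simp: not_less split: if_splits)
  next
    fix c assume "c \<in> {\<kappa> (k - i)..<a}"
    then show "c \<in> {c. c < a \<and> (a - c) + conjugate \<kappa> c \<le> k}"
      using *[of c] by auto
  qed
  then show "card {c. c < a \<and> (a - c) + conjugate \<kappa> c \<le> k} = i"
    by (simp add: a)
qed

text \<open>Induction on \<open>r\<close> strips first rows until \<open>first_row_of_core\<close>
  applies. Its index \<open>k - i\<close> counts rows below the first one, hence the offset
  \<open>k + 1 - i\<close> in \<open>\<kappa>\<close> itself.\<close>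

lemma core_row:
  assumes "\<kappa> \<in> cores (k + 1)"
  shows "core_to_bounded k \<kappa> r \<le> k \<and>
    \<kappa> r = core_to_bounded k \<kappa> r + \<kappa> (r + (k + 1 - core_to_bounded k \<kappa> r))"
  using assms
proof (induction r arbitrary: \<kappa>)
  case 0
  define a \<kappa>' where "a = \<kappa> 0" and "\<kappa>' = (\<lambda>r. \<kappa> (Suc r))"
  have \<kappa>: "\<kappa> = case_nat a \<kappa>'"
    by (simp add: a_def \<kappa>'_def case_nat_head_tail)
  have c: "\<kappa>' \<in> cores (k + 1)" "\<kappa>' 0 \<le> a" "\<forall>c<a. (a - c) + conjugate \<kappa>' c \<noteq> k + 1"
    using 0 unfolding \<kappa> case_nat_in_cores_iff by blast+
  then have "is_partition \<kappa>'"
    by (simp add: cores_def)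
  from first_row_of_core[OF this c(2,3) refl] show ?case
    by (simp add: \<kappa> core_to_bounded_case_nat Suc_diff_le)
next
  case (Suc r)
  define a \<kappa>' where "a = \<kappa> 0" and "\<kappa>' = (\<lambda>r. \<kappa> (Suc r))"
  have \<kappa>: "\<kappa> = case_nat a \<kappa>'"
    by (simp add: a_def \<kappa>'_def case_nat_head_tail)
  have "\<kappa>' \<in> cores (k + 1)"
    using Suc.prems unfolding \<kappa> case_nat_in_cores_iff by blast
  from Suc.IH[OF this] show ?case
    by (simp add: \<kappa> core_to_bounded_case_nat)
qed

text \<open>If the part in row \<open>Suc r\<close> were larger than that in row \<open>r\<close>,
  its recurrence would refer to a row no lower, hence at least as long, and row \<open>Suc r\<close>
  of the core would be longer than row \<open>r\<close>.\<close>

lemma antimono_core_to_bounded: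
  assumes "\<kappa> \<in> cores (k + 1)"
  shows "antimono (core_to_bounded k \<kappa>)"
  unfolding antimono_iff_le_Suc
proof (rule allI, rule ccontr)
  fix r
  let ?\<mu> = "core_to_bounded k \<kappa>"
  assume "\<not> ?\<mu> (Suc r) \<le> ?\<mu> r"
  have anti: "antimono \<kappa>"
    using assms by (simp add: cores_def is_partition_def)
  have "\<kappa> (r + (k + 1 - ?\<mu> r)) \<le> \<kappa> (Suc r + (k + 1 - ?\<mu> (Suc r)))"
    using core_row[OF assms, of "Suc r"] \<open>\<not> ?\<mu> (Suc r) \<le> ?\<mu> r\<close>
    by (intro antimonoD[OF anti]) linarith
  moreover have "\<kappa> (Suc r) \<le> \<kappa> r"
    by (rule antimonoD[OF anti]) simp
  ultimately show False
    using core_row[OF assms, of r] core_row[OF assms, of "Suc r"] \<open>\<not> ?\<mu> (Suc r) \<le> ?\<mu> r\<close>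
    by linarith
qed

section \<open>Bijectivity of the map from cores to bounded partitions\<close>

lemma partition_eventually_0:
  assumes "is_partition \<mu>"
  obtains N where "\<And>r. N \<le> r \<Longrightarrow> \<mu> r = 0"
proof
  show "\<mu> r = 0" if "conjugate \<mu> 0 \<le> r" for r
    using that less_conjugate_iff[OF assms, of r 0] by simp
qed

text \<open>A zero part gives \<open>\<kappa> r = \<kappa> (r + k + 1)\<close>; the part there is
  zero as well, so the argument repeats until it leaves the support of \<open>\<kappa>\<close>. Thus
  no nonempty row of a core is lost.\<close>

lemma core_to_bounded_eq_0_iff:
  assumes "\<kappa> \<in> cores (k + 1)"
  shows "core_to_bounded k \<kappa> r = 0 \<longleftrightarrow> \<kappa> r = 0"
proof
  assume "core_to_bounded k \<kappa> r = 0"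
  obtain N where N: "\<And>r. N \<le> r \<Longrightarrow> \<kappa> r = 0"
    using assms partition_eventually_0 by (auto simp: cores_def)
  from \<open>core_to_bounded k \<kappa> r = 0\<close> show "\<kappa> r = 0"
  proof (induction "N - r" arbitrary: r rule: less_induct)
    case less
    show ?case
    proof (cases "N \<le> r")
      case False
      have "core_to_bounded k \<kappa> (r + (k + 1)) = 0"
        using antimonoD[OF antimono_core_to_bounded[OF assms], of r "r + (k + 1)"] less.prems
        by simp
      then have "\<kappa> (r + (k + 1)) = 0"
        using False by (intro less.hyps) auto
      then show ?thesis
        using core_row[OF assms, of r] less.prems by simp
    qed (rule N)
  qed
next
  assume "\<kappa> r = 0"
  then show "core_to_bounded k \<kappa> r = 0"
    using core_row[OF assms, of r] by simp
qed

text \<open>The parts are at most \<open>k\<close>, so the recurrence in \<open>core_row\<close>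
  refers to strictly lower rows and determines the core from the bottom up.\<close>

lemma inj_on_core_to_bounded: "inj_on (core_to_bounded k) (cores (k + 1))"
proof (rule inj_onI, rule ext)
  fix \<kappa> \<kappa>' r
  assume \<kappa>: "\<kappa> \<in> cores (k + 1)" and \<kappa>': "\<kappa>' \<in> cores (k + 1)"
    and eq: "core_to_bounded k \<kappa> = core_to_bounded k \<kappa>'"
  obtain M where M: "\<And>r. M \<le> r \<Longrightarrow> \<kappa> r = 0"
    using \<kappa> partition_eventually_0 by (auto simp: cores_def)
  obtain N where N: "\<And>r. N \<le> r \<Longrightarrow> \<kappa>' r = 0"
    using \<kappa>' partition_eventually_0 by (auto simp: cores_def)
  show "\<kappa> r = \<kappa>' r"
  proof (induction "M + N - r" arbitrary: r rule: less_induct)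
    case less
    show ?case
    proof (cases "M + N \<le> r")
      case True
      then show ?thesis
        by (simp add: M N)
    next
      case False
      let ?t = "r + (k + 1 - core_to_bounded k \<kappa> r)"
      have "\<kappa> ?t = \<kappa>' ?t"
        using False core_row[OF \<kappa>, of r] by (intro less.hyps) linarith
      then show ?thesis
        using core_row[OF \<kappa>, of r] core_row[OF \<kappa>', of r] eq by simp
    qed
  qed
qed

text \<open>The length of the new row is forced by \<open>first_row_of_core\<close>. That it is at
  least \<open>\<kappa> 0\<close> follows from the recurrence for row \<open>0\<close>, since the
  old first part is at most \<open>i\<close>.\<close>

lemma case_nat_core:
  assumes "\<kappa> \<in> cores (k + 1)" and "core_to_bounded k \<kappa> 0 \<le> i" and "i \<le> k"
  shows "case_nat (i + \<kappa> (k - i)) \<kappa> \<in> cores (k + 1)"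
    and "core_to_bounded k (case_nat (i + \<kappa> (k - i)) \<kappa>) = case_nat i (core_to_bounded k \<kappa>)"
proof -
  have part: "is_partition \<kappa>"
    using assms by (simp add: cores_def)
  then have "antimono \<kappa>"
    by (simp add: is_partition_def)
  then have "\<kappa> (k + 1 - core_to_bounded k \<kappa> 0) \<le> \<kappa> (k - i)"
    by (rule antimonoD) (use assms in linarith)
  then have "\<kappa> 0 \<le> i + \<kappa> (k - i)"
    using core_row[OF assms(1), of 0] assms(2) by simp
  with new_first_row_of_core[OF part assms(3) refl] assms(1)
  show "case_nat (i + \<kappa> (k - i)) \<kappa> \<in> cores (k + 1)"
    and "core_to_bounded k (case_nat (i + \<kappa> (k - i)) \<kappa>) = case_nat i (core_to_bounded k \<kappa>)"
    by (simp_all add: case_nat_in_cores_iff core_to_bounded_case_nat)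
qed

lemma zero_core:
  "(\<lambda>_. 0) \<in> cores n" "core_to_bounded k (\<lambda>_. 0) = (\<lambda>_. 0)"
  by (simp_all add: cores_def is_partition_def cells_def core_to_bounded_def fun_eq_iff monotone_on_def)

text \<open>Surjectivity: the core is built from the bottom row upwards by
  \<open>case_nat_core\<close>, with \<open>N\<close> bounding the number of rows.\<close>

lemma bounded_partition_in_image:
  assumes "is_partition \<mu>" and "\<mu> 0 \<le> k"
  shows "\<mu> \<in> core_to_bounded k ` cores (k + 1)"
proof -
  obtain N where N: "\<And>r. N \<le> r \<Longrightarrow> \<mu> r = 0"
    using assms(1) partition_eventually_0 by blast
  from assms N show ?thesis
  proof (induction N arbitrary: \<mu>)
    case 0
    then have "\<mu> = (\<lambda>_. 0)"
      by auto
    then show ?case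
      using zero_core by (metis imageI)
  next
    case (Suc N)
    define i \<mu>' where "i = \<mu> 0" and "\<mu>' = (\<lambda>r. \<mu> (Suc r))"
    have \<mu>: "\<mu> = case_nat i \<mu>'"
      by (simp add: i_def \<mu>'_def case_nat_head_tail)
    have part: "is_partition \<mu>'" "\<mu>' 0 \<le> i"
      using Suc.prems(1) by (simp_all add: \<mu> is_partition_case_nat)
    have "i \<le> k"
      using Suc.prems(2) by (simp add: i_def)
    have "\<mu>' \<in> core_to_bounded k ` cores (k + 1)"
      using part \<open>i \<le> k\<close> Suc.prems(3) by (intro Suc.IH) (auto simp: \<mu>'_def)
    then obtain \<kappa> where \<kappa>: "\<kappa> \<in> cores (k + 1)" "core_to_bounded k \<kappa> = \<mu>'"
      by auto
    then show ?case
      using case_nat_core[OF \<kappa>(1) _ \<open>i \<le> k\<close>] part(2) by (metis \<mu> imageI)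
  qed
qed

section \<open>The inverse map and the rectangle condition\<close>

definition core_of :: "nat \<Rightarrow> (nat \<Rightarrow> nat) \<Rightarrow> nat \<Rightarrow> nat" where
  "core_of k = inv_into (cores (k + 1)) (core_to_bounded k)"

lemma core_of_core_to_bounded: "\<kappa> \<in> cores (k + 1) \<Longrightarrow> core_of k (core_to_bounded k \<kappa>) = \<kappa>"
  unfolding core_of_def by (rule inv_into_f_f[OF inj_on_core_to_bounded])

lemma core_of:
  assumes "is_partition \<mu>" and "\<mu> 0 \<le> k"
  shows core_of_in_cores: "core_of k \<mu> \<in> cores (k + 1)"
    and core_to_bounded_core_of: "core_to_bounded k (core_of k \<mu>) = \<mu>"
  using bounded_partition_in_image[OF assms]
  by (simp_all add: core_of_def inv_into_into f_inv_into_f)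

lemma core_of_zero: "core_of k (\<lambda>_. 0) = (\<lambda>_. 0)"
  using core_of_core_to_bounded[OF zero_core(1)] by (simp add: zero_core)

lemma core_of_case_nat:
  assumes "is_partition \<mu>" and "\<mu> 0 \<le> i" and "i \<le> k"
  shows "core_of k (case_nat i \<mu>) = case_nat (i + core_of k \<mu> (k - i)) (core_of k \<mu>)"
proof -
  have "\<mu> 0 \<le> k"
    using assms by simp
  note \<mu> = core_of[OF assms(1) this]
  show ?thesis
    using case_nat_core[OF \<mu>(1) _ assms(3)] core_of_core_to_bounded assms(2) \<mu>(2) by metis
qed

text \<open>The width bound is automatic by \<open>core_row\<close>, and
  \<open>core_to_bounded\<close> empties no row, so only the number of rows of the transposed core
  matters.\<close>

lemma k_conjugate_in_rectangle_iff:
  assumes "is_partition \<mu>" and "\<mu> 0 \<le> k"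
  shows "cells (k_conjugate k \<mu>) \<subseteq> cells (rectangle k l) \<longleftrightarrow> core_of k \<mu> 0 \<le> l"
proof -
  let ?\<kappa> = "core_of k \<mu>"
  have \<kappa>: "?\<kappa> \<in> cores (k + 1)"
    by (rule core_of_in_cores[OF assms])
  then have part: "is_partition ?\<kappa>"
    by (simp add: cores_def)
  let ?\<nu> = "core_to_bounded k (conjugate ?\<kappa>)"
  have \<nu>: "k_conjugate k \<mu> = ?\<nu>"
    by (simp add: k_conjugate_def core_of_def)
  have core: "conjugate ?\<kappa> \<in> cores (k + 1)"
    by (rule conjugate_in_cores[OF \<kappa>])
  have pos: "0 < ?\<nu> r \<longleftrightarrow> r < ?\<kappa> 0" for r
    using core_to_bounded_eq_0_iff[OF core, of r] less_conjugate_iff[OF part, of 0 r]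
    by (metis neq0_conv)
  have le: "?\<nu> r \<le> k" for r
    using core_row[OF core] by simp
  show ?thesis
    unfolding \<nu>
  proof
    assume sub: "cells ?\<nu> \<subseteq> cells (rectangle k l)"
    \<comment> \<open>Otherwise the cell \<open>(l, 0)\<close> would lie outside the
      rectangle.\<close>
    have "\<not> l < ?\<kappa> 0"
      using sub pos[of l] by (auto simp: cells_def rectangle_def)
    then show "?\<kappa> 0 \<le> l"
      by simp
  next
    assume "?\<kappa> 0 \<le> l"
    have "c < rectangle k l r" if "c < ?\<nu> r" for r c
      using that le[of r] pos[of r] \<open>?\<kappa> 0 \<le> l\<close> by (auto simp: rectangle_def)
    then show "cells ?\<nu> \<subseteq> cells (rectangle k l)"
      by (auto simp: cells_def)
  qed
qed

section \<open>Gaussian binomial coefficients\<close>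

text \<open>The q-Pascal rule avoids polynomial division and gives the value \<open>0\<close> for
  \<open>b > a\<close>, so sums may run past the natural range.\<close>

fun gauss :: "nat \<Rightarrow> nat \<Rightarrow> int poly" where
  "gauss n 0 = 1"
| "gauss 0 (Suc b) = 0"
| "gauss (Suc a) (Suc b) = gauss a b + qX ^ Suc b * gauss a (Suc b)"

lemma gauss_eq_0: "a < b \<Longrightarrow> gauss a b = 0"
  by (induction a b rule: gauss.induct) auto

lemma gauss_self: "gauss a a = 1"
  by (induction a) (auto simp: gauss_eq_0)

text \<open>Evaluation at \<open>1\<close> sends \<open>qint m\<close> to \<open>m\<close>. This
  permits cancelling q-factorials.\<close>

lemma qfact_nonzero: "qfact n \<noteq> 0"
proof -
  have "poly (qint m) 1 = int m" for m
    by (simp add: qint_def poly_sum)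
  then have "qint m \<noteq> 0" if "0 < m" for m
    using that by (metis of_nat_0_eq_iff poly_0 less_irrefl)
  then show ?thesis
    by (auto simp: qfact_def)
qed

text \<open>After multiplication by the q-factorials, q-Pascal becomes
  \<open>[a+1] = [b+1] + q^(b+1) [a-b]\<close>, an instance of \<open>qint_add\<close>.\<close>

lemma gauss_mult_qfact:
  assumes "b \<le> a"
  shows "gauss a b * (qfact b * qfact (a - b)) = qfact a"
  using assms
proof (induction a b rule: gauss.induct)
  case (1 n)
  then show ?case by (simp add: qfact_def)
next
  case (2 b)
  then show ?case by simp
next
  case (3 a b)
  show ?case
  proof (cases "a = b")
    \<comment> \<open>On the diagonal there is no induction hypothesis for
      \<open>gauss a (Suc b)\<close>; \<open>gauss_self\<close> covers this case.\<close>
    case True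
    then show ?thesis
      using gauss_self[of "Suc b"] by (simp add: qfact_def del: gauss.simps)
  next
    case False
    then have "b < a"
      using 3 by simp
    then have d: "Suc a - Suc b = Suc (a - Suc b)" "a - b = Suc (a - Suc b)"
      "Suc a = Suc b + Suc (a - Suc b)"
      by simp_all
    let ?F = "qfact (Suc b) * qfact (Suc a - Suc b)"
    have "gauss a b * ?F = (gauss a b * (qfact b * qfact (a - b))) * qint (Suc b)"
      by (simp add: qfact_Suc[of b])
    also have "\<dots> = qfact a * qint (Suc b)"
      using 3 \<open>b < a\<close> by simp
    finally have 1: "gauss a b * ?F = qfact a * qint (Suc b)" .
    have "gauss a (Suc b) * ?F =
        (gauss a (Suc b) * (qfact (Suc b) * qfact (a - Suc b))) * qint (Suc (a - Suc b))"
      unfolding d(1) qfact_Suc[of "a - Suc b"] by (simp only: mult_ac)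
    also have "\<dots> = qfact a * qint (Suc (a - Suc b))"
      using 3 \<open>b < a\<close> by simp
    finally have 2: "gauss a (Suc b) * ?F = qfact a * qint (Suc (a - Suc b))" .
    have "gauss (Suc a) (Suc b) * ?F = gauss a b * ?F + qX ^ Suc b * (gauss a (Suc b) * ?F)"
      by (simp only: gauss.simps algebra_simps)
    also have "\<dots> = qfact a * (qint (Suc b) + qX ^ Suc b * qint (Suc (a - Suc b)))"
      unfolding 1 2 by (simp only: algebra_simps)
    also have "\<dots> = qfact a * qint (Suc a)"
      using qint_add[of "Suc b" "Suc (a - Suc b)"] d(3) by metis
    finally show ?thesis
      by (simp only: qfact_Suc)
  qed
qed

lemma qbinom_eq_gauss: "b \<le> a \<Longrightarrow> qbinom a b = gauss a b"
  by (metis qbinom_exact gauss_mult_qfact mult_right_cancel qfact_nonzero mult_eq_0_iff)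

text \<open>Either side times \<open>?Q\<close> is \<open>qfact k\<close>: both are the
  q-multinomial coefficient of \<open>j\<close>, \<open>i - j\<close>, \<open>k - i\<close>.\<close>

lemma gauss_trinomial_revision:
  assumes "j \<le> i" and "i \<le> k"
  shows "gauss (k - j) (i - j) * gauss k j = gauss k i * gauss i j"
proof -
  let ?Q = "qfact j * qfact (i - j) * qfact (k - i)"
  have "gauss (k - j) (i - j) * gauss k j * ?Q =
      gauss k j * (qfact j * (gauss (k - j) (i - j) * (qfact (i - j) * qfact (k - j - (i - j)))))"
    using assms by (simp add: mult_ac)
  also have "\<dots> = gauss k j * (qfact j * qfact (k - j))"
    using assms by (subst gauss_mult_qfact) auto
  also have "\<dots> = qfact k"
    using assms by (simp add: gauss_mult_qfact)
  also have "\<dots> = gauss k i * (gauss i j * (qfact j * qfact (i - j)) * qfact (k - i))"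
    using assms by (simp add: gauss_mult_qfact)
  also have "\<dots> = gauss k i * gauss i j * ?Q"
    by (simp only: mult_ac)
  finally show ?thesis
    using qfact_nonzero by (metis mult_right_cancel mult_eq_0_iff)
qed

text \<open>Induction on \<open>m\<close>, with q-Pascal applied to the first factor. Truncation in
  \<open>m - s\<close> is harmless, as \<open>gauss m s\<close> vanishes for
  \<open>s > m\<close>.\<close>

lemma gauss_Vandermonde:
  "(\<Sum>s\<le>r. gauss m s * gauss n (r - s) * qX ^ ((m - s) * (r - s))) = gauss (m + n) r"
proof (induction m arbitrary: r)
  case 0
  have "(\<Sum>s\<le>r. gauss 0 s * gauss n (r - s) * qX ^ ((0 - s) * (r - s))) =
      (\<Sum>s\<in>{0}. gauss 0 s * gauss n (r - s) * qX ^ ((0 - s) * (r - s)))"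
    by (rule sum.mono_neutral_right) (auto simp: gauss_eq_0)
  then show ?case
    by simp
next
  case (Suc m)
  show ?case
  proof (cases r)
    case 0
    then show ?thesis by simp
  next
    case r: (Suc t)
    let ?f = "\<lambda>s. gauss m s * gauss n (r - s) * qX ^ ((m - s) * (r - s))"
    \<comment> \<open>The exponent \<open>(s + 1) + (m - s) (t - s)\<close> equals
      \<open>r + (m - s - 1) (r - s - 1)\<close>, so the second Pascal terms form \<open>q^r\<close>
      times the sum for \<open>m\<close> and \<open>r\<close>; the separate term
      \<open>s = 0\<close> completes it.\<close>
    have shift: "qX ^ Suc s * gauss m (Suc s) * gauss n (t - s) * qX ^ ((m - s) * (t - s))
        = qX ^ r * ?f (Suc s)" if "s \<le> t" for s
    proof (cases "Suc s \<le> m")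
      case True
      then have "Suc s + (m - s) * (t - s) = r + (m - Suc s) * (r - Suc s)"
        using that r by (simp add: Suc_diff_Suc[symmetric])
      then have e: "qX ^ Suc s * qX ^ ((m - s) * (t - s)) = qX ^ r * qX ^ ((m - Suc s) * (r - Suc s))"
        by (metis power_add)
      have "qX ^ Suc s * gauss m (Suc s) * gauss n (t - s) * qX ^ ((m - s) * (t - s))
        = (qX ^ Suc s * qX ^ ((m - s) * (t - s))) * (gauss m (Suc s) * gauss n (t - s))"
        by (simp only: mult_ac)
      also have "\<dots> = qX ^ r * ?f (Suc s)"
        unfolding e using r by (simp only: mult_ac diff_Suc_Suc)
      finally show ?thesis .
    qed (simp add: gauss_eq_0)
    have "(\<Sum>s\<le>r. gauss (Suc m) s * gauss n (r - s) * qX ^ ((Suc m - s) * (r - s))) =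
      gauss n r * qX ^ (Suc m * r) +
      (\<Sum>s\<le>t. gauss (Suc m) (Suc s) * gauss n (t - s) * qX ^ ((m - s) * (t - s)))"
      unfolding r by (subst sum.atMost_Suc_shift) simp
    also have "(\<Sum>s\<le>t. gauss (Suc m) (Suc s) * gauss n (t - s) * qX ^ ((m - s) * (t - s))) =
      (\<Sum>s\<le>t. gauss m s * gauss n (t - s) * qX ^ ((m - s) * (t - s))) +
      (\<Sum>s\<le>t. qX ^ Suc s * gauss m (Suc s) * gauss n (t - s) * qX ^ ((m - s) * (t - s)))"
      by (simp only: gauss.simps sum.distrib[symmetric] algebra_simps)
    also have "(\<Sum>s\<le>t. qX ^ Suc s * gauss m (Suc s) * gauss n (t - s) * qX ^ ((m - s) * (t - s))) =
      (\<Sum>s\<le>t. qX ^ r * ?f (Suc s))"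
      using shift by (intro sum.cong) auto
    also have "gauss n r * qX ^ (Suc m * r) +
      ((\<Sum>s\<le>t. gauss m s * gauss n (t - s) * qX ^ ((m - s) * (t - s))) +
       (\<Sum>s\<le>t. qX ^ r * ?f (Suc s))) =
      (\<Sum>s\<le>t. gauss m s * gauss n (t - s) * qX ^ ((m - s) * (t - s))) +
      (qX ^ r * ?f 0 + (\<Sum>s\<le>t. qX ^ r * ?f (Suc s)))"
      by (simp add: power_add mult_ac)
    also have "qX ^ r * ?f 0 + (\<Sum>s\<le>t. qX ^ r * ?f (Suc s)) = qX ^ r * (\<Sum>s\<le>r. ?f s)"
      unfolding sum_distrib_left using r by (simp only: sum.atMost_Suc_shift)
    \<comment> \<open>The induction hypotheses at \<open>t\<close> and at \<open>r = Suc t\<close>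
      recombine by q-Pascal.\<close>
    finally show ?thesis
      unfolding Suc.IH using r by simp
  qed
qed

section \<open>Generating functions\<close>

definition genfun :: "(nat \<Rightarrow> nat) set \<Rightarrow> int poly" where
  "genfun A = (\<Sum>\<mu>\<in>A. qX ^ psize \<mu>)"

lemma inj_case_nat: "inj (case_nat i :: (nat \<Rightarrow> nat) \<Rightarrow> nat \<Rightarrow> nat)"
proof (rule injI, rule ext)
  fix \<mu> \<nu> :: "nat \<Rightarrow> nat" and r
  assume "case_nat i \<mu> = case_nat i \<nu>"
  from fun_cong[OF this, of "Suc r"] show "\<mu> r = \<nu> r"
    by simp
qed

lemma genfun_image_case_nat:
  assumes "A \<subseteq> Collect is_partition"
  shows "genfun (case_nat i ` A) = qX ^ i * genfun A"
proof -
  have "genfun (case_nat i ` A) = (\<Sum>\<mu>\<in>A. qX ^ psize (case_nat i \<mu>))"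
    unfolding genfun_def by (subst sum.reindex) (auto intro: inj_on_subset[OF inj_case_nat])
  also have "\<dots> = (\<Sum>\<mu>\<in>A. qX ^ i * qX ^ psize \<mu>)"
    using assms by (intro sum.cong) (auto simp: psize_case_nat power_add)
  finally show ?thesis
    by (simp add: genfun_def sum_distrib_left)
qed

section \<open>Splitting partitions by their first part\<close>

definition core_row_partitions :: "nat \<Rightarrow> nat \<Rightarrow> nat \<Rightarrow> nat \<Rightarrow> (nat \<Rightarrow> nat) set" where
  "core_row_partitions k i m n = {\<mu>. is_partition \<mu> \<and> \<mu> 0 \<le> i \<and> core_of k \<mu> m = n}"

text \<open>The generating function of this set is the \<open>F_i(n)\<close> of the
  overview.\<close>

definition exact_partitions :: "nat \<Rightarrow> nat \<Rightarrow> nat \<Rightarrow> (nat \<Rightarrow> nat) set" where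
  "exact_partitions k i n = {\<mu>. is_partition \<mu> \<and> \<mu> 0 = i \<and> core_of k \<mu> 0 = n}"

lemma partition_eq_zero:
  assumes "is_partition \<mu>" and "\<mu> 0 = 0"
  shows "\<mu> = (\<lambda>_. 0)"
proof
  fix r
  show "\<mu> r = 0"
    using assms antimonoD[of \<mu> 0 r] by (simp add: is_partition_def)
qed

lemma exact_partitions_0: "exact_partitions k 0 n = (if n = 0 then {\<lambda>_. 0} else {})"
  using zero_core(1)[of 0]
  by (auto simp: exact_partitions_def core_of_zero cores_def dest: partition_eq_zero)

lemma image_case_nat_eqI:
  assumes "\<And>\<mu>. \<mu> \<in> A \<Longrightarrow> \<mu> 0 = i"
    and "\<And>\<mu>. case_nat i \<mu> \<in> A \<longleftrightarrow> \<mu> \<in> B"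
  shows "A = case_nat i ` B"
proof (intro set_eqI iffI)
  fix \<mu> assume "\<mu> \<in> A"
  then show "\<mu> \<in> case_nat i ` B"
    using assms by (metis case_nat_head_tail imageI)
qed (use assms(2) in auto)

text \<open>By \<open>core_of_case_nat\<close> a new first part \<open>i\<close> makes the first
  core row \<open>i\<close> plus row \<open>k - i\<close> of the old core, so that old row must have
  length \<open>n - i\<close>.\<close>

lemma exact_partitions_eq_image:
  assumes "i \<le> k"
  shows "exact_partitions k i n =
    (if n < i then {} else case_nat i ` core_row_partitions k i (k - i) (n - i))"
proof -
  have "exact_partitions k i n =
      case_nat i ` {\<mu> \<in> core_row_partitions k i (k - i) (n - i). i \<le> n}"
    using assms
    by (intro image_case_nat_eqI)
      (auto simp: exact_partitions_def core_row_partitions_def is_partition_case_nat core_of_case_nat)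
  then show ?thesis
    by auto
qed

lemma core_row_partitions_row_0:
  "core_row_partitions k i 0 n = (\<Union>j\<le>i. exact_partitions k j n)"
  by (auto simp: core_row_partitions_def exact_partitions_def)

lemma core_row_partitions_part_0:
  "core_row_partitions k 0 m n = exact_partitions k 0 n"
  by (auto simp: core_row_partitions_def exact_partitions_def core_of_zero dest: partition_eq_zero)

text \<open>The first part is at most \<open>i\<close> or equal to \<open>Suc i\<close>; removing it
  in the second case turns core row \<open>Suc m\<close> into row \<open>m\<close>.\<close>

lemma core_row_partitions_Suc_Suc:
  assumes "Suc i \<le> k"
  shows "core_row_partitions k (Suc i) (Suc m) n =
    core_row_partitions k i (Suc m) n \<union> case_nat (Suc i) ` core_row_partitions k (Suc i) m n"
proof -
  have "{\<mu> \<in> core_row_partitions k (Suc i) (Suc m) n. \<mu> 0 = Suc i} =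
      case_nat (Suc i) ` core_row_partitions k (Suc i) m n"
    using assms
    by (intro image_case_nat_eqI)
      (auto simp: core_row_partitions_def is_partition_case_nat core_of_case_nat)
  moreover have "core_row_partitions k (Suc i) (Suc m) n = core_row_partitions k i (Suc m) n \<union>
      {\<mu> \<in> core_row_partitions k (Suc i) (Suc m) n. \<mu> 0 = Suc i}"
    by (auto simp: core_row_partitions_def)
  ultimately show ?thesis
    by simp
qed

text \<open>The rows above row \<open>m\<close> form a partition in an \<open>m\<close> by \<open>i - j\<close> box on top of an \<open>m\<close> by \<open>j\<close>
  rectangle, where \<open>j\<close> is the part in row \<open>m\<close>.\<close>

lemma genfun_core_row_partitions:
  assumes "i \<le> k" and "\<And>j. j \<le> i \<Longrightarrow> finite (exact_partitions k j n)"
  shows "finite (core_row_partitions k i m n) \<and> genfun (core_row_partitions k i m n) =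
    (\<Sum>j\<le>i. qX ^ (j * m) * gauss (m + (i - j)) (i - j) * genfun (exact_partitions k j n))"
  using assms
proof (induction m arbitrary: i)
  case 0
  have "genfun (\<Union>j\<le>i. exact_partitions k j n) = (\<Sum>j\<le>i. genfun (exact_partitions k j n))"
    unfolding genfun_def
    by (rule sum.UNION_disjoint) (use 0 in \<open>auto simp: exact_partitions_def\<close>)
  then show ?case
    using 0 by (simp add: core_row_partitions_row_0 gauss_self)
next
  case (Suc m)
  \<comment> \<open>Saved for the inner induction on \<open>i\<close>, where the split by first part
    lowers either \<open>i\<close> or \<open>m\<close>.\<close>
  note row = Suc.IH
  from Suc.prems show ?case
  proof (induction i)
    case 0
    then show ?case
      by (simp add: core_row_partitions_part_0)
  next
    case (Suc i)
    let ?G = "\<lambda>j. genfun (exact_partitions k j n)"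
    have i: "finite (core_row_partitions k i (Suc m) n)"
      "genfun (core_row_partitions k i (Suc m) n) =
        (\<Sum>j\<le>i. qX ^ (j * Suc m) * gauss (Suc m + (i - j)) (i - j) * ?G j)"
      using Suc by simp_all
    have m: "finite (core_row_partitions k (Suc i) m n)"
      "genfun (core_row_partitions k (Suc i) m n) =
        (\<Sum>j\<le>Suc i. qX ^ (j * m) * gauss (m + (Suc i - j)) (Suc i - j) * ?G j)"
      using row[OF Suc.prems] by simp_all
    have "core_row_partitions k i (Suc m) n \<inter>
        case_nat (Suc i) ` core_row_partitions k (Suc i) m n = {}"
      by (auto simp: core_row_partitions_def)
    then have "genfun (core_row_partitions k (Suc i) (Suc m) n) =
        genfun (core_row_partitions k i (Suc m) n) +
        genfun (case_nat (Suc i) ` core_row_partitions k (Suc i) m n)"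
      unfolding core_row_partitions_Suc_Suc[OF Suc.prems(1)] genfun_def
      using i(1) m(1) by (intro sum.union_disjoint) auto
    also have "genfun (case_nat (Suc i) ` core_row_partitions k (Suc i) m n) =
        qX ^ Suc i * genfun (core_row_partitions k (Suc i) m n)"
      by (rule genfun_image_case_nat) (auto simp: core_row_partitions_def)
    also have "genfun (core_row_partitions k i (Suc m) n) + \<dots> =
      (\<Sum>j\<le>i. qX ^ (j * Suc m) * gauss (Suc m + (i - j)) (i - j) * ?G j +
        qX ^ Suc i * (qX ^ (j * m) * gauss (m + (Suc i - j)) (Suc i - j) * ?G j)) +
      qX ^ Suc i * (qX ^ (Suc i * m) * ?G (Suc i))"
      unfolding i m sum_distrib_left sum.distrib by simp
    also have "(\<Sum>j\<le>i. qX ^ (j * Suc m) * gauss (Suc m + (i - j)) (i - j) * ?G j +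
        qX ^ Suc i * (qX ^ (j * m) * gauss (m + (Suc i - j)) (Suc i - j) * ?G j)) =
      (\<Sum>j\<le>i. qX ^ (j * Suc m) * gauss (Suc m + (Suc i - j)) (Suc i - j) * ?G j)"
    proof (rule sum.cong)
      fix j assume "j \<in> {..i}"
      then obtain d where d: "i = j + d"
        using le_Suc_ex by blast
      \<comment> \<open>The surplus power \<open>Suc d\<close>, with \<open>d = i - j\<close>, is
        the weight that q-Pascal requires.\<close>
      have "qX ^ Suc i * qX ^ (j * m) = qX ^ (j * Suc m) * qX ^ Suc d"
        unfolding power_add[symmetric] by (simp add: d add_ac)
      then have "qX ^ (j * Suc m) * gauss (Suc m + d) d * ?G j +
          qX ^ Suc i * (qX ^ (j * m) * gauss (Suc m + d) (Suc d) * ?G j) =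
          qX ^ (j * Suc m) * (gauss (Suc m + d) d + qX ^ Suc d * gauss (Suc m + d) (Suc d)) * ?G j"
        by (simp only: mult.assoc[symmetric] distrib_left distrib_right)
      then show "qX ^ (j * Suc m) * gauss (Suc m + (i - j)) (i - j) * ?G j +
        qX ^ Suc i * (qX ^ (j * m) * gauss (m + (Suc i - j)) (Suc i - j) * ?G j) =
        qX ^ (j * Suc m) * gauss (Suc m + (Suc i - j)) (Suc i - j) * ?G j"
        by (simp add: d Suc_diff_le)
    qed simp
    also have "\<dots> + qX ^ Suc i * (qX ^ (Suc i * m) * ?G (Suc i)) =
      (\<Sum>j\<le>Suc i. qX ^ (j * Suc m) * gauss (Suc m + (Suc i - j)) (Suc i - j) * ?G j)"
      by (simp add: power_add mult_ac)
    finally show ?case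
      using i(1) m(1) by (simp add: core_row_partitions_Suc_Suc[OF Suc.prems(1)])
  qed
qed

section \<open>Closed form of the generating functions\<close>

lemma gauss_sum:
  assumes "1 \<le> i" and "i \<le> k"
  shows "(\<Sum>s\<le>i. qX ^ (s * (k - i)) * gauss (k - i + (i - s)) (i - s) *
      (if j < s then 0 else
        qX ^ s * gauss k s * qX ^ ((j - s) * (k + 1 - s)) * gauss (j - 1) (j - s))) =
    gauss k i * qX ^ (j * (k + 1 - i)) * gauss (i + j - 1) j"
  (is "(\<Sum>s\<le>i. ?f s) = ?rhs")
proof -
  let ?c = "gauss k i * qX ^ (j * (k + 1 - i))"
  \<comment> \<open>The Vandermonde summand for \<open>i\<close> and \<open>j - 1\<close>: trinomial
    revision moves \<open>s\<close> from the coefficients in \<open>k\<close> to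
    \<open>gauss i s\<close>, leaving the factor \<open>?c\<close> free of \<open>s\<close>.\<close>
  let ?g = "\<lambda>s. gauss i s * gauss (j - 1) (j - s) * qX ^ ((i - s) * (j - s))"
  have summand: "?f s = ?c * ?g s" if le: "s \<le> i" "s \<le> j" for s
  proof -
    obtain a b c where abc: "i = s + a" "k = i + b" "j = s + c"
      using le_Suc_ex[OF le(1)] le_Suc_ex[OF le(2)] le_Suc_ex[OF assms(2)] by blast
    have "qX ^ (s * (k - i)) * qX ^ s * qX ^ ((j - s) * (k + 1 - s)) =
        qX ^ (j * (k + 1 - i)) * qX ^ ((i - s) * (j - s))"
      unfolding power_add[symmetric] by (simp add: abc algebra_simps)
    moreover have "gauss (k - i + (i - s)) (i - s) * gauss k s = gauss k i * gauss i s"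
      using gauss_trinomial_revision[OF le(1) assms(2)] le assms by simp
    moreover have "?f s = (qX ^ (s * (k - i)) * qX ^ s * qX ^ ((j - s) * (k + 1 - s))) *
        (gauss (k - i + (i - s)) (i - s) * gauss k s) * gauss (j - 1) (j - s)"
      using le by (simp only: if_False not_less[symmetric] mult_ac)
    ultimately show ?thesis
      by (simp only: mult_ac)
  qed
  \<comment> \<open>The range changes from \<open>s \<le> i\<close> to \<open>s \<le> j\<close>:
    terms with \<open>s > j\<close> are zero by the conditional, those with \<open>s > i\<close>
    because \<open>gauss i s = 0\<close>.\<close>
  have "(\<Sum>s\<le>i. ?f s) = (\<Sum>s\<in>{..i} \<inter> {..j}. ?f s)"
    by (rule sum.mono_neutral_right) auto
  also have "\<dots> = (\<Sum>s\<in>{..i} \<inter> {..j}. ?c * ?g s)"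
    by (rule sum.cong[OF refl], rule summand) auto
  also have "\<dots> = (\<Sum>s\<le>j. ?c * ?g s)"
    by (rule sum.mono_neutral_left) (auto simp: gauss_eq_0)
  also have "\<dots> = ?c * gauss (i + (j - 1)) j"
    by (simp only: sum_distrib_left[symmetric] gauss_Vandermonde)
  \<comment> \<open>For \<open>j = 0\<close> the upper indices differ by truncation, but both
    coefficients are \<open>1\<close>.\<close>
  also have "gauss (i + (j - 1)) j = gauss (i + j - 1) j"
    by (cases j) auto
  finally show ?thesis .
qed

text \<open>Strong induction on \<open>n\<close>: removing a first part \<open>i > 0\<close>
  replaces \<open>n\<close> by \<open>n - i\<close>, and \<open>gauss_sum\<close> evaluates the
  resulting sum. Finiteness is carried along for \<open>genfun_core_row_partitions\<close>.\<close>

lemma genfun_exact_partitions: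
  assumes "i \<le> k"
  shows "finite (exact_partitions k i n) \<and> genfun (exact_partitions k i n) =
    (if n < i then 0 else
      qX ^ i * gauss k i * qX ^ ((n - i) * (k + 1 - i)) * gauss (n - 1) (n - i))"
  using assms
proof (induction n arbitrary: i rule: less_induct)
  case (less n)
  show ?case
  proof (cases "i = 0")
    case True
    \<comment> \<open>Only the zero partition occurs; correspondingly \<open>gauss (n - 1) n\<close>
      is \<open>1\<close> at \<open>n = 0\<close>, by truncation, and \<open>0\<close>
      otherwise.\<close>
    show ?thesis
      by (cases n) (auto simp: True exact_partitions_0 genfun_def psize_def gauss_eq_0)
  next
    case False
    show ?thesis
    proof (cases "n < i")
      case True
      then show ?thesis
        using less.prems by (simp add: exact_partitions_eq_image genfun_def)
    next
      case n: False
      define j where "j = n - i"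
      have j: "n = i + j" "j < n"
        using n False by (auto simp: j_def)
      have IH: "finite (exact_partitions k s j) \<and> genfun (exact_partitions k s j) =
          (if j < s then 0 else
            qX ^ s * gauss k s * qX ^ ((j - s) * (k + 1 - s)) * gauss (j - 1) (j - s))"
        if "s \<le> i" for s
        using less.IH[OF j(2), of s] that less.prems by simp
      have rows: "finite (core_row_partitions k i (k - i) j)"
        "genfun (core_row_partitions k i (k - i) j) =
          gauss k i * qX ^ (j * (k + 1 - i)) * gauss (i + j - 1) j"
      proof -
        have T: "finite (core_row_partitions k i (k - i) j) \<and>
          genfun (core_row_partitions k i (k - i) j) =
          (\<Sum>s\<le>i. qX ^ (s * (k - i)) * gauss (k - i + (i - s)) (i - s) *
            genfun (exact_partitions k s j))"
          using IH less.prems by (intro genfun_core_row_partitions) auto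
        then show "finite (core_row_partitions k i (k - i) j)"
          by blast
        show "genfun (core_row_partitions k i (k - i) j) =
          gauss k i * qX ^ (j * (k + 1 - i)) * gauss (i + j - 1) j"
          unfolding conjunct2[OF T] using False less.prems
          by (subst gauss_sum[symmetric]) (auto simp: IH intro!: sum.cong)
      qed
      have S: "exact_partitions k i n = case_nat i ` core_row_partitions k i (k - i) j"
        using n less.prems by (simp add: exact_partitions_eq_image j_def)
      have "genfun (exact_partitions k i n) = qX ^ i * genfun (core_row_partitions k i (k - i) j)"
        unfolding S by (rule genfun_image_case_nat) (auto simp: core_row_partitions_def)
      then show ?thesis
        using n rows(1) unfolding rows(2) by (simp add: S flip: j_def) (simp add: j(1) mult_ac)
    qed
  qed
qed

theorem theorem1p1:
  fixes k l i :: nat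
  assumes "1 \<le> k" and "1 \<le> l" and "1 \<le> i" and "i \<le> min k l"
  shows "qX ^ i * qbinom k i * qbinom_prime k l i =
    (\<Sum>\<mu> | is_partition \<mu> \<and> \<mu> 0 = i \<and> cells (k_conjugate k \<mu>) \<subseteq> cells (rectangle k l).
       qX ^ psize \<mu>)"
proof -
  have "i \<le> k"
    using assms by simp
  let ?J = "{j. i + j \<le> l}"
  have "finite ?J"
    by (rule finite_subset[of _ "{..l}"]) auto
  \<comment> \<open>The class with \<open>n < i\<close> is empty. So the first core row has length
    \<open>i + j\<close>, with \<open>j\<close> becoming the summation index of the primed
    coefficient.\<close>
  have ge: "i \<le> core_of k \<mu> 0" if "is_partition \<mu>" "\<mu> 0 = i" for \<mu>
  proof -
    have "\<mu> \<in> exact_partitions k i (core_of k \<mu> 0)"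
      using that by (simp add: exact_partitions_def)
    then show ?thesis
      using exact_partitions_eq_image[OF \<open>i \<le> k\<close>, of "core_of k \<mu> 0"] by (auto split: if_splits)
  qed
  have "(is_partition \<mu> \<and> \<mu> 0 = i \<and> cells (k_conjugate k \<mu>) \<subseteq> cells (rectangle k l)) \<longleftrightarrow>
      (\<exists>j\<in>?J. \<mu> \<in> exact_partitions k i (i + j))" for \<mu>
  proof (cases "is_partition \<mu> \<and> \<mu> 0 = i")
    case True
    then obtain j where "core_of k \<mu> 0 = i + j"
      using ge le_Suc_ex by blast
    then show ?thesis
      using True k_conjugate_in_rectangle_iff[of \<mu> k l] \<open>i \<le> k\<close> by (simp add: exact_partitions_def)
  qed (auto simp: exact_partitions_def)
  then have "{\<mu>. is_partition \<mu> \<and> \<mu> 0 = i \<and> cells (k_conjugate k \<mu>) \<subseteq> cells (rectangle k l)} =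
      (\<Union>j\<in>?J. exact_partitions k i (i + j))"
    by auto
  then have "(\<Sum>\<mu> | is_partition \<mu> \<and> \<mu> 0 = i \<and> cells (k_conjugate k \<mu>) \<subseteq> cells (rectangle k l).
       qX ^ psize \<mu>) = (\<Sum>j\<in>?J. genfun (exact_partitions k i (i + j)))"
    unfolding genfun_def using \<open>finite ?J\<close> genfun_exact_partitions[OF \<open>i \<le> k\<close>]
    by (simp only:) (rule sum.UNION_disjoint, auto simp: exact_partitions_def)
  \<comment> \<open>At \<open>n = i + j\<close> the closed form is the \<open>j\<close>-th summand;
    \<open>1 \<le> i\<close> ensures \<open>j \<le> i + j - 1\<close>, as
    \<open>qbinom_eq_gauss\<close> demands.\<close>
  also have "\<dots> = (\<Sum>j\<in>?J. qX ^ i * qbinom k i * (qX ^ (j * (k + 1 - i)) * qbinom (i + j - 1) j))"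
    using assms
    by (intro sum.cong) (simp_all add: genfun_exact_partitions qbinom_eq_gauss mult_ac)
  finally show ?thesis
    by (simp add: qbinom_prime_def sum_distrib_left)
qed

end
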